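(* Let $d\ge 2$, let $F_1,\dots,F_d$ be distribution functions, and let $(X_1,\dots,X_d)$ be a random vector with $X_i\sim F_i$ for all $i$. If $(X_1,\dots,X_d)$ solves the problem defining $M$ (resp. the problem defining $m$), then for any choice of subset $I$ of $\{1,2,\dots,d\}$ it holds that $\prod_{i\in I}X_i$ and $\prod_{i\notin I}X_i$ are comonotonic (resp. antimonotonic).
   Context: All random variables $X_i\sim F_i$ are assumed to be square integrable, where $X\sim F$ means that $X$ has distribution function $F$. Define $M=\sup \mathbb{E}(Y_1Y_2\cdots Y_d)$ and $m=\inf \mathbb{E}(Y_1Y_2\cdots Y_d)$, where the supremum and infimum are over all random vectors $(Y_1,\dots,Y_d)$ with $Y_i\sim F_i$ for all $i=1,\dots,d$ (the marginal distributions are fixed, the dependence is arbitrary). The vector $(X_1,\dots,X_d)$ solves the problem defining $M$ (resp. $m$) if $X_i\sim F_i$ for all $i$ and $\mathbb{E}(X_1X_2\cdots X_d)=M$ (resp. $=m$). An empty product equals $1$. Two random variables $Y,Z$ with distribution functions $H,K$ and quantile functions $H^{-1},K^{-1}$ are comonotonic if $(Y,Z)$ has the same law as $(H^{-1}(U),K^{-1}(U))$, and antimonotonic if $(Y,Z)$ has the same law as $(H^{-1}(U),K^{-1}(1-U))$, where $U$ is uniformly distributed on $[0,1]$.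
   Formalization: The formal theorem additionally assumes that X_1⋯X_d is integrable, i.e. that the attained M (resp. m) is finite; for d≥3 the claim fails when the optimum is infinite, since a vector comonotone only in the upper tail can also attain it. *)

theory Defs
  imports "HOL-Probability.Probability"
begin

definition distribution_function :: "(real \<Rightarrow> real) \<Rightarrow> bool" where
  "distribution_function F \<longleftrightarrow>
     mono F \<and> (\<forall>x. continuous (at_right x) F) \<and>
     (F \<longlongrightarrow> 0) at_bot \<and> (F \<longlongrightarrow> 1) at_top"

definition has_df :: "'a measure \<Rightarrow> ('a \<Rightarrow> real) \<Rightarrow> (real \<Rightarrow> real) \<Rightarrow> bool" where
  "has_df P X F \<longleftrightarrow> X \<in> borel_measurable P \<and> cdf (distr P borel X) = F"

text \<open>Vectors of length \<open>d\<close> are families indexed by \<open>{1..d}\<close>; values at other indices are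
  irrelevant.\<close>

definition random_vector_with_marginals ::
    "'a measure \<Rightarrow> nat \<Rightarrow> (nat \<Rightarrow> real \<Rightarrow> real) \<Rightarrow> (nat \<Rightarrow> 'a \<Rightarrow> real) \<Rightarrow> bool" where
  "random_vector_with_marginals P d F X \<longleftrightarrow>
     prob_space P \<and> (\<forall>i\<in>{1..d}. has_df P (X i) (F i))"

text \<open>Expectation with values in the extended reals. For \<open>d \<ge> 3\<close> the product of square integrable
  variables need not be integrable, so Bochner integrals (which are 0 by convention on
  non-integrable functions) cannot be used inside the supremum and infimum. The difference below
  is meaningful only when at most one of the two parts is infinite.\<close>

definition expectation_exists :: "'a measure \<Rightarrow> ('a \<Rightarrow> real) \<Rightarrow> bool" where
  "expectation_exists P Z \<longleftrightarrow> Z \<in> borel_measurable P \<and>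
     ((\<integral>\<^sup>+\<omega>. ennreal (Z \<omega>) \<partial>P) < \<infinity> \<or> (\<integral>\<^sup>+\<omega>. ennreal (- Z \<omega>) \<partial>P) < \<infinity>)"

definition ext_expectation :: "'a measure \<Rightarrow> ('a \<Rightarrow> real) \<Rightarrow> ereal" where
  "ext_expectation P Z =
     enn2ereal (\<integral>\<^sup>+\<omega>. ennreal (Z \<omega>) \<partial>P) - enn2ereal (\<integral>\<^sup>+\<omega>. ennreal (- Z \<omega>) \<partial>P)"

lemma ext_expectation_integrable:
  assumes "integrable P Z"
  shows "expectation_exists P Z" "ext_expectation P Z = ereal (integral\<^sup>L P Z)"
proof -
  have fin: "(\<integral>\<^sup>+\<omega>. ennreal (Z \<omega>) \<partial>P) \<noteq> \<infinity>" "(\<integral>\<^sup>+\<omega>. ennreal (- Z \<omega>) \<partial>P) \<noteq> \<infinity>"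
    using assms unfolding real_integrable_def by auto
  then show "expectation_exists P Z"
    using assms by (auto simp: expectation_exists_def less_top)
  obtain a b where ab: "0 \<le> a" "0 \<le> b" "(\<integral>\<^sup>+\<omega>. ennreal (Z \<omega>) \<partial>P) = ennreal a"
      "(\<integral>\<^sup>+\<omega>. ennreal (- Z \<omega>) \<partial>P) = ennreal b"
    using fin by (metis ennreal_cases infinity_ennreal_def)
  then show "ext_expectation P Z = ereal (integral\<^sup>L P Z)"
    by (simp add: ext_expectation_def real_lebesgue_integral_def[OF assms] enn2ereal_ennreal)
qed

text \<open>HOL cannot quantify over the underlying type of a probability space inside a definition.
  Taking spaces on \<open>nat \<Rightarrow> real\<close> loses nothing: every random vector can be realised as the
  coordinate process of its joint law, as shown by the lemma that follows.\<close>

definition product_expectations :: "nat \<Rightarrow> (nat \<Rightarrow> real \<Rightarrow> real) \<Rightarrow> ereal set" where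
  "product_expectations d F =
     {ext_expectation N (\<lambda>\<omega>. \<Prod>i\<in>{1..d}. Y i \<omega>) | (N :: (nat \<Rightarrow> real) measure) Y.
        random_vector_with_marginals N d F Y \<and>
        expectation_exists N (\<lambda>\<omega>. \<Prod>i\<in>{1..d}. Y i \<omega>)}"

lemma product_expectations_any_space:
  fixes P :: "'a measure"
  assumes "random_vector_with_marginals P d F Y"
    and "expectation_exists P (\<lambda>\<omega>. \<Prod>i\<in>{1..d}. Y i \<omega>)"
  shows "ext_expectation P (\<lambda>\<omega>. \<Prod>i\<in>{1..d}. Y i \<omega>) \<in> product_expectations d F"
proof -
  interpret prob_space P
    using assms(1) by (simp add: random_vector_with_marginals_def)
  define T where "T \<omega> = (\<lambda>i\<in>{1..d}. Y i \<omega>)" for \<omega>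
  define N where "N = distr P (PiM {1..d} (\<lambda>_. borel)) T"
  have Y: "Y i \<in> borel_measurable P" "cdf (distr P borel (Y i)) = F i" if "i \<in> {1..d}" for i
    using assms(1) that by (auto simp: random_vector_with_marginals_def has_df_def)
  have T: "T \<in> measurable P (PiM {1..d} (\<lambda>_. borel))"
    unfolding T_def using Y(1) by (rule measurable_restrict)
  have coord: "(\<lambda>x. x i) \<in> borel_measurable (PiM {1..d} (\<lambda>_. borel))" if "i \<in> {1..d}"
    for i :: nat
    using that by (rule measurable_component_singleton)
  have "distr N borel (\<lambda>x. x i) = distr P borel (Y i)" if "i \<in> {1..d}" for i
    unfolding N_def distr_distr[OF coord[OF that] T]
    by (rule distr_cong) (use that in \<open>auto simp: T_def\<close>)
  then have rv: "random_vector_with_marginals N d F (\<lambda>i x. x i)"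
    using coord Y(2) prob_space_distr[OF T]
    by (auto simp: random_vector_with_marginals_def has_df_def N_def)
  have prod: "(\<lambda>x. \<Prod>i\<in>{1..d}. x i) \<in> borel_measurable (PiM {1..d} (\<lambda>_. borel :: real measure))"
    using coord by (intro borel_measurable_prod) auto
  have Tprod: "(\<Prod>i\<in>{1..d}. T \<omega> i) = (\<Prod>i\<in>{1..d}. Y i \<omega>)" for \<omega>
    by (rule prod.cong) (auto simp: T_def)
  have eqs: "(\<integral>\<^sup>+x. ennreal (\<Prod>i\<in>{1..d}. x i) \<partial>N) = (\<integral>\<^sup>+\<omega>. ennreal (\<Prod>i\<in>{1..d}. Y i \<omega>) \<partial>P)"
       "(\<integral>\<^sup>+x. ennreal (- (\<Prod>i\<in>{1..d}. x i)) \<partial>N) = (\<integral>\<^sup>+\<omega>. ennreal (- (\<Prod>i\<in>{1..d}. Y i \<omega>)) \<partial>P)"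
    using prod by (simp_all add: N_def nn_integral_distr[OF T] Tprod del: One_nat_def)
  have "expectation_exists N (\<lambda>x. \<Prod>i\<in>{1..d}. x i)"
    using assms(2) prod unfolding expectation_exists_def eqs by (simp add: N_def)
  moreover have "ext_expectation P (\<lambda>\<omega>. \<Prod>i\<in>{1..d}. Y i \<omega>) =
      ext_expectation N (\<lambda>x. \<Prod>i\<in>{1..d}. x i)"
    unfolding ext_expectation_def eqs ..
  ultimately show ?thesis
    using rv unfolding product_expectations_def mem_Collect_eq
    by (intro exI[of _ N] exI[of _ "\<lambda>i x. x i"]) simp
qed

definition max_product :: "nat \<Rightarrow> (nat \<Rightarrow> real \<Rightarrow> real) \<Rightarrow> ereal" where
  "max_product d F = Sup (product_expectations d F)"

definition min_product :: "nat \<Rightarrow> (nat \<Rightarrow> real \<Rightarrow> real) \<Rightarrow> ereal" where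
  "min_product d F = Inf (product_expectations d F)"

definition solves_max ::
    "'a measure \<Rightarrow> nat \<Rightarrow> (nat \<Rightarrow> real \<Rightarrow> real) \<Rightarrow> (nat \<Rightarrow> 'a \<Rightarrow> real) \<Rightarrow> bool" where
  "solves_max P d F X \<longleftrightarrow> random_vector_with_marginals P d F X \<and>
     expectation_exists P (\<lambda>\<omega>. \<Prod>i\<in>{1..d}. X i \<omega>) \<and>
     ext_expectation P (\<lambda>\<omega>. \<Prod>i\<in>{1..d}. X i \<omega>) = max_product d F"

definition solves_min ::
    "'a measure \<Rightarrow> nat \<Rightarrow> (nat \<Rightarrow> real \<Rightarrow> real) \<Rightarrow> (nat \<Rightarrow> 'a \<Rightarrow> real) \<Rightarrow> bool" where
  "solves_min P d F X \<longleftrightarrow> random_vector_with_marginals P d F X \<and>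
     expectation_exists P (\<lambda>\<omega>. \<Prod>i\<in>{1..d}. X i \<omega>) \<and>
     ext_expectation P (\<lambda>\<omega>. \<Prod>i\<in>{1..d}. X i \<omega>) = min_product d F"

text \<open>On \<open>{0<..<1}\<close> this is the usual left-continuous generalised inverse. At the end points the
  quantile may be infinite and the real \<open>Inf\<close> is then an arbitrary value; these are null sets for
  the uniform distribution.\<close>

definition quantile :: "(real \<Rightarrow> real) \<Rightarrow> real \<Rightarrow> real" where
  "quantile H u = Inf {x. u \<le> H x}"

definition comonotonic :: "'a measure \<Rightarrow> ('a \<Rightarrow> real) \<Rightarrow> ('a \<Rightarrow> real) \<Rightarrow> bool" where
  "comonotonic P Y Z \<longleftrightarrow> Y \<in> borel_measurable P \<and> Z \<in> borel_measurable P \<and>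
     distr P borel (\<lambda>\<omega>. (Y \<omega>, Z \<omega>)) =
     distr (uniform_measure lborel {0..1}) borel
       (\<lambda>u. (quantile (cdf (distr P borel Y)) u, quantile (cdf (distr P borel Z)) u))"

definition antimonotonic :: "'a measure \<Rightarrow> ('a \<Rightarrow> real) \<Rightarrow> ('a \<Rightarrow> real) \<Rightarrow> bool" where
  "antimonotonic P Y Z \<longleftrightarrow> Y \<in> borel_measurable P \<and> Z \<in> borel_measurable P \<and>
     distr P borel (\<lambda>\<omega>. (Y \<omega>, Z \<omega>)) =
     distr (uniform_measure lborel {0..1}) borel
       (\<lambda>u. (quantile (cdf (distr P borel Y)) u, quantile (cdf (distr P borel Z)) (1 - u)))"

end

theory Submission
  imports Defs
begin

text \<open>Take two independent copies \<open>\<omega>\<close>, \<open>\<omega>'\<close> of the sample point and a symmetric event \<open>R\<close>. Replacing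
  the coordinates \<open>X i \<omega>\<close> with \<open>i \<notin> I\<close> by \<open>X i \<omega>'\<close> on \<open>R\<close> preserves every marginal, and by symmetry
  changes the expectation of \<open>A B\<close>, where \<open>A\<close> and \<open>B\<close> are the two partial products, by
  \<open>- E[(A \<omega> - A \<omega>') (B \<omega> - B \<omega>'); R] / 2\<close>. Choosing \<open>R\<close> to be the event that this integrand is
  negative (truncated, so that everything stays integrable), optimality forces
  \<open>(A \<omega> - A \<omega>') (B \<omega> - B \<omega>') \<ge> 0\<close> almost surely. By independence,
  \<open>P(A \<le> x, B > y) P(A > x, B \<le> y) = 0\<close>, so the joint distribution function is the minimum of the
  marginal ones, which characterises comonotonicity. The minimisation problem is the same with the
  signs reversed.\<close>

section \<open>Lower orthants and quantile functions\<close>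

text \<open>Lower orthants generate the Borel sets and are stable under intersection, since two of
  them meet in the orthant at the infimum of their corners. In dimension two this reduces equality
  of joint laws to equality of joint distribution functions.\<close>

lemma finite_borel_measure_eqI_atMost:
  fixes M N :: "'a::ordered_euclidean_space measure"
  assumes "finite_measure M" "sets M = sets borel" "sets N = sets borel"
    and eq: "\<And>a. emeasure M {..a} = emeasure N {..a}"
  shows "M = N"
proof (rule measure_eqI_generator_eq)
  let ?E = "range (\<lambda>a::'a. {..a})"
  have "{..a} \<inter> {..b} = {..inf a b}" for a b :: 'a
    by auto
  then show "Int_stable ?E"
    unfolding Int_stable_def by auto
  show "sets M = sigma_sets UNIV ?E" "sets N = sigma_sets UNIV ?E"
    using assms(2,3) by (simp_all add: borel_eq_atMost)
  show "emeasure M S = emeasure N S" if "S \<in> ?E" for S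
    using that eq by auto
  show "range (\<lambda>n. {..real n *\<^sub>R (One::'a)}) \<subseteq> ?E"
    by auto
  show "(\<Union>n. {..real n *\<^sub>R (One::'a)}) = UNIV"
  proof safe
    fix x :: 'a
    obtain n where "Max ((\<bullet>) x ` Basis) \<le> real n"
      using real_arch_simple by blast
    then show "x \<in> (\<Union>n. {..real n *\<^sub>R (One::'a)})"
      by (auto simp: eucl_le[where 'a='a] inner_sum_left inner_Basis intro!: exI[of _ n])
  qed auto
  show "emeasure M {..real n *\<^sub>R (One::'a)} \<noteq> \<infinity>" for n
    using finite_measure.emeasure_finite[OF assms(1)] by auto
qed auto

text \<open>For \<open>u\<close> strictly between 0 and 1 the set
  \<open>{x. u \<le> cdf M x}\<close> is nonempty and bounded below, and right-continuity puts its
  infimum into the set.\<close>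

lemma quantile_le_iff:
  assumes "real_distribution M" "0 < u" "u < 1"
  shows "quantile (cdf M) u \<le> x \<longleftrightarrow> u \<le> cdf M x"
proof -
  interpret cdf_distribution M
    by (simp add: cdf_distribution_def assms(1))
  show ?thesis
    unfolding quantile_def by (rule pseudoinverse[OF assms(2,3), symmetric])
qed

lemma borel_measurable_quantile:
  assumes "real_distribution M"
  shows "quantile (cdf M) \<in> borel_measurable borel"
proof -
  interpret cdf_distribution M
    by (simp add: cdf_distribution_def assms)
  let ?g = "\<lambda>u. indicator {0<..<1} u *\<^sub>R quantile (cdf M) u"
  have "quantile (cdf M) \<in> borel_measurable (restrict_space borel {0<..<1})"
    unfolding quantile_def[abs_def] by (rule measurable_CI)
  then have g: "?g \<in> borel_measurable borel"
    by (subst (asm) borel_measurable_restrict_space_iff) auto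
  \<comment> \<open>Off the open unit interval the infimum is taken over a fixed set on each of the
    rays \<open>u \<le> 0\<close> and \<open>u > 1\<close>. So \<open>quantile\<close> is constant
    there, whatever the default value of \<open>Inf\<close>, and only the point 1 remains.\<close>
  have "{x. u \<le> cdf M x} = UNIV" if "u \<le> 0" for u
    using that order_trans[OF that cdf_nonneg] by auto
  moreover have "{x. u \<le> cdf M x} = {}" if "u > 1" for u
    using that cdf_bounded_prob by (auto simp: not_le intro: le_less_trans)
  ultimately have "quantile (cdf M) =
      (\<lambda>u. if u \<le> 0 then Inf UNIV else if u > 1 then Inf {} else
        if u = 1 then quantile (cdf M) 1 else ?g u)"
    by (auto simp: quantile_def fun_eq_iff)
  also have "\<dots> \<in> borel_measurable borel"
    using g by measurable
  finally show ?thesis .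
qed

section \<open>Joint distribution functions of comonotonic and antimonotonic pairs\<close>

context prob_space
begin

lemma cdf_distr:
  assumes "Y \<in> borel_measurable M"
  shows "cdf (distr M borel Y) x = prob {\<omega>\<in>space M. Y \<omega> \<le> x}"
  unfolding cdf_def using assms by (subst measure_distr) (auto intro!: arg_cong[where f=prob])

text \<open>The hypothesis is the upper Frechet-Hoeffding bound. Up to null sets, the two quantiles
  at \<open>u\<close> are at most \<open>x\<close> and \<open>y\<close> exactly when
  \<open>u \<le> min (H x) (K y)\<close>, which has this minimum as its uniform probability.\<close>

lemma comonotonicI:
  assumes [measurable]: "Y \<in> borel_measurable M" "Z \<in> borel_measurable M"
    and joint: "\<And>x y. prob {\<omega>\<in>space M. Y \<omega> \<le> x \<and> Z \<omega> \<le> y} =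
      min (prob {\<omega>\<in>space M. Y \<omega> \<le> x}) (prob {\<omega>\<in>space M. Z \<omega> \<le> y})"
  shows "comonotonic M Y Z"
proof -
  define H K where "H = cdf (distr M borel Y)" and "K = cdf (distr M borel Z)"
  have YZ: "real_distribution (distr M borel Y)" "real_distribution (distr M borel Z)"
    by auto
  have [measurable]: "quantile H \<in> borel_measurable borel" "quantile K \<in> borel_measurable borel"
    unfolding H_def K_def by (intro borel_measurable_quantile YZ)+
  let ?U = "uniform_measure lborel {0..1::real}"
  let ?D = "distr M borel (\<lambda>\<omega>. (Y \<omega>, Z \<omega>))"
  have "?D = distr ?U borel (\<lambda>u. (quantile H u, quantile K u))"
  proof (rule finite_borel_measure_eqI_atMost)
    show "finite_measure ?D"
      by (intro prob_space.finite_measure prob_space_distr) simp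
    fix a :: "real \<times> real"
    obtain x y where a: "a = (x, y)" by force
    have HK: "0 \<le> H x" "H x \<le> 1" "0 \<le> K y" "K y \<le> 1"
      by (auto simp: H_def K_def cdf_distr)
    have "emeasure ?D {..a} = emeasure M {\<omega>\<in>space M. Y \<omega> \<le> x \<and> Z \<omega> \<le> y}"
      by (subst emeasure_distr) (auto simp: a intro!: arg_cong[where f="emeasure M"])
    also have "\<dots> = ennreal (min (H x) (K y))"
      by (simp add: emeasure_eq_measure joint H_def K_def cdf_distr)
    also have "\<dots> = emeasure lborel {0..min (H x) (K y)}"
      using HK by simp
    also have "\<dots> = emeasure lborel ({0..1} \<inter> {u. quantile H u \<le> x \<and> quantile K u \<le> y})"
    proof (rule emeasure_eq_AE)
      \<comment> \<open>The end points 0 and 1, where \<open>quantile\<close> may be a default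
        value, are discarded as null sets.\<close>
      show "AE u in lborel. u \<in> {0..min (H x) (K y)} \<longleftrightarrow>
          u \<in> {0..1} \<inter> {u. quantile H u \<le> x \<and> quantile K u \<le> y}"
        using AE_lborel_singleton[of 0] AE_lborel_singleton[of 1]
      proof eventually_elim
        case (elim u)
        show ?case
        proof (cases "0 < u \<and> u < 1")
          case True
          then show ?thesis
            using quantile_le_iff[OF YZ(1), of u x] quantile_le_iff[OF YZ(2), of u y]
            by (auto simp: H_def K_def)
        qed (use elim HK in auto)
      qed
    qed measurable
    also have "\<dots> = emeasure ?U {u. quantile H u \<le> x \<and> quantile K u \<le> y}"
      by (subst emeasure_uniform_measure) (auto simp: divide_ennreal_def)
    also have "\<dots> = emeasure (distr ?U borel (\<lambda>u. (quantile H u, quantile K u))) {..a}"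
      by (subst emeasure_distr) (simp_all add: a vimage_def)
    finally show "emeasure ?D {..a} = \<dots>" .
  qed auto
  then show ?thesis
    by (simp add: comonotonic_def H_def K_def)
qed

text \<open>The hypothesis is the lower Frechet-Hoeffding bound. Evaluating the second quantile at
  \<open>1 - u\<close> turns its condition into \<open>1 - K y \<le> u\<close>, so the event becomes
  the interval from \<open>1 - K y\<close> to \<open>H x\<close>.\<close>

lemma antimonotonicI:
  assumes [measurable]: "Y \<in> borel_measurable M" "Z \<in> borel_measurable M"
    and joint: "\<And>x y. prob {\<omega>\<in>space M. Y \<omega> \<le> x \<and> Z \<omega> \<le> y} =
      max 0 (prob {\<omega>\<in>space M. Y \<omega> \<le> x} + prob {\<omega>\<in>space M. Z \<omega> \<le> y} - 1)"
  shows "antimonotonic M Y Z"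
proof -
  define H K where "H = cdf (distr M borel Y)" and "K = cdf (distr M borel Z)"
  have YZ: "real_distribution (distr M borel Y)" "real_distribution (distr M borel Z)"
    by auto
  have [measurable]: "quantile H \<in> borel_measurable borel" "quantile K \<in> borel_measurable borel"
    unfolding H_def K_def by (intro borel_measurable_quantile YZ)+
  let ?U = "uniform_measure lborel {0..1::real}"
  let ?D = "distr M borel (\<lambda>\<omega>. (Y \<omega>, Z \<omega>))"
  have "?D = distr ?U borel (\<lambda>u. (quantile H u, quantile K (1 - u)))"
  proof (rule finite_borel_measure_eqI_atMost)
    show "finite_measure ?D"
      by (intro prob_space.finite_measure prob_space_distr) simp
    fix a :: "real \<times> real"
    obtain x y where a: "a = (x, y)" by force
    have HK: "0 \<le> H x" "H x \<le> 1" "0 \<le> K y" "K y \<le> 1"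
      by (auto simp: H_def K_def cdf_distr)
    have "emeasure ?D {..a} = emeasure M {\<omega>\<in>space M. Y \<omega> \<le> x \<and> Z \<omega> \<le> y}"
      by (subst emeasure_distr) (auto simp: a intro!: arg_cong[where f="emeasure M"])
    also have "\<dots> = ennreal (max 0 (H x + K y - 1))"
      by (simp add: emeasure_eq_measure joint H_def K_def cdf_distr)
    \<comment> \<open>The maximum with 0 accounts for the case where this interval is empty.\<close>
    also have "\<dots> = emeasure lborel {1 - K y..H x}"
      by (auto simp: max_def emeasure_lborel_Icc_eq algebra_simps)
    also have "\<dots> = emeasure lborel ({0..1} \<inter> {u. quantile H u \<le> x \<and> quantile K (1 - u) \<le> y})"
    proof (rule emeasure_eq_AE)
      show "AE u in lborel. u \<in> {1 - K y..H x} \<longleftrightarrow>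
          u \<in> {0..1} \<inter> {u. quantile H u \<le> x \<and> quantile K (1 - u) \<le> y}"
        using AE_lborel_singleton[of 0] AE_lborel_singleton[of 1]
      proof eventually_elim
        case (elim u)
        show ?case
        proof (cases "0 < u \<and> u < 1")
          case True
          then show ?thesis
            using quantile_le_iff[OF YZ(1), of u x] quantile_le_iff[OF YZ(2), of "1 - u" y]
            by (auto simp: H_def K_def)
        qed (use elim HK in auto)
      qed
    qed measurable
    also have "\<dots> = emeasure ?U {u. quantile H u \<le> x \<and> quantile K (1 - u) \<le> y}"
      by (subst emeasure_uniform_measure) (auto simp: divide_ennreal_def)
    also have "\<dots> = emeasure (distr ?U borel (\<lambda>u. (quantile H u, quantile K (1 - u)))) {..a}"
      by (subst emeasure_distr) (simp_all add: a vimage_def)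
    finally show "emeasure ?D {..a} = \<dots>" .
  qed auto
  then show ?thesis
    by (simp add: antimonotonic_def H_def K_def)
qed

section \<open>From the sign condition on two independent copies to the joint law\<close>

lemma null_Times_imp:
  assumes "C \<in> events" "D \<in> events" "AE z in M \<Otimes>\<^sub>M M. z \<notin> C \<times> D"
  shows "prob C = 0 \<or> prob D = 0"
proof -
  have "emeasure (M \<Otimes>\<^sub>M M) (C \<times> D) = 0"
    using assms by (intro AE_iff_measurable[THEN iffD1, of _ _ "\<lambda>z. z \<notin> C \<times> D"])
      (auto dest: sets.sets_into_space simp: space_pair_measure)
  then show ?thesis
    using assms(1,2) by (simp add: emeasure_pair_measure_Times emeasure_eq_measure)
qed

lemma comonotonic_if_AE_pair:
  assumes [measurable]: "Y \<in> borel_measurable M" "Z \<in> borel_measurable M"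
    and ae: "AE z in M \<Otimes>\<^sub>M M. 0 \<le> (Y (fst z) - Y (snd z)) * (Z (fst z) - Z (snd z))"
  shows "comonotonic M Y Z"
proof (rule comonotonicI)
  fix x y
  let ?J = "{\<omega>\<in>space M. Y \<omega> \<le> x \<and> Z \<omega> \<le> y}"
  let ?C = "{\<omega>\<in>space M. Y \<omega> \<le> x \<and> y < Z \<omega>}"
  let ?D = "{\<omega>\<in>space M. x < Y \<omega> \<and> Z \<omega> \<le> y}"
  \<comment> \<open>On \<open>?C \<times> ?D\<close> the increment of \<open>Y\<close> is negative
    and that of \<open>Z\<close> positive, so their product is strictly negative.\<close>
  have "AE z in M \<Otimes>\<^sub>M M. z \<notin> ?C \<times> ?D"
    using ae by eventually_elim (auto simp: zero_le_mult_iff)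
  then have "prob ?C = 0 \<or> prob ?D = 0"
    by (intro null_Times_imp) measurable
  moreover have "prob {\<omega>\<in>space M. Y \<omega> \<le> x} = prob ?J + prob ?C"
    by (subst finite_measure_Union[symmetric]) (auto intro!: arg_cong[where f=prob])
  moreover have "prob {\<omega>\<in>space M. Z \<omega> \<le> y} = prob ?J + prob ?D"
    by (subst finite_measure_Union[symmetric]) (auto intro!: arg_cong[where f=prob])
  ultimately show "prob ?J = min (prob {\<omega>\<in>space M. Y \<omega> \<le> x}) (prob {\<omega>\<in>space M. Z \<omega> \<le> y})"
    using measure_nonneg[of M ?C] measure_nonneg[of M ?D] by (smt (verit))
qed fact+

text \<open>Here the forbidden rectangle pairs a point where both variables are low with one where
  both are high. The two marginal values sum to \<open>1 + prob ?J - prob ?D\<close>, so when one of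
  these probabilities vanishes, \<open>prob ?J\<close> is the positive part of the
  difference.\<close>

lemma antimonotonic_if_AE_pair:
  assumes [measurable]: "Y \<in> borel_measurable M" "Z \<in> borel_measurable M"
    and ae: "AE z in M \<Otimes>\<^sub>M M. (Y (fst z) - Y (snd z)) * (Z (fst z) - Z (snd z)) \<le> 0"
  shows "antimonotonic M Y Z"
proof (rule antimonotonicI)
  fix x y
  let ?J = "{\<omega>\<in>space M. Y \<omega> \<le> x \<and> Z \<omega> \<le> y}"
  let ?C = "{\<omega>\<in>space M. Y \<omega> \<le> x \<and> y < Z \<omega>}"
  let ?D = "{\<omega>\<in>space M. x < Y \<omega> \<and> y < Z \<omega>}"
  have "AE z in M \<Otimes>\<^sub>M M. z \<notin> ?J \<times> ?D"
    using ae by eventually_elim (auto simp: mult_le_0_iff)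
  then have "prob ?J = 0 \<or> prob ?D = 0"
    by (intro null_Times_imp) measurable
  moreover have "prob {\<omega>\<in>space M. Y \<omega> \<le> x} = prob ?J + prob ?C"
    by (subst finite_measure_Union[symmetric]) (auto intro!: arg_cong[where f=prob])
  moreover have "1 - prob {\<omega>\<in>space M. Z \<omega> \<le> y} = prob ?C + prob ?D"
    by (subst finite_measure_Union[symmetric], simp_all add: prob_compl[symmetric])
      (auto intro!: arg_cong[where f=prob])
  ultimately show "prob ?J =
      max 0 (prob {\<omega>\<in>space M. Y \<omega> \<le> x} + prob {\<omega>\<in>space M. Z \<omega> \<le> y} - 1)"
    using measure_nonneg[of M ?J] measure_nonneg[of M ?D] by (smt (verit))
qed fact+

section \<open>Swapping coordinates on a symmetric event\<close>

text \<open>Exchanging the two copies preserves the product measure and maps \<open>R\<close> to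
  itself. Hence, restricted to \<open>R\<close>, \<open>f (snd z)\<close> and
  \<open>f (fst z)\<close> are distributed alike, and off \<open>R\<close> nothing is
  changed.\<close>

lemma distr_swap_on_symmetric:
  assumes f[measurable]: "f \<in> measurable M N" and R[measurable]: "R \<in> sets (M \<Otimes>\<^sub>M M)"
    and sym: "\<And>x y. (x, y) \<in> R \<longleftrightarrow> (y, x) \<in> R"
  shows "distr (M \<Otimes>\<^sub>M M) N (\<lambda>z. if z \<in> R then f (snd z) else f (fst z)) = distr M N f"
proof (rule measure_eqI)
  interpret Q: pair_prob_space M M ..
  let ?Q = "M \<Otimes>\<^sub>M M" and ?T = "\<lambda>z. if z \<in> R then f (snd z) else f (fst z)"
  fix A assume "A \<in> sets (distr ?Q N ?T)"
  then have A[measurable]: "A \<in> sets N" by simp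
  let ?E = "{z\<in>space ?Q. z \<in> R \<and> f (snd z) \<in> A}"
  let ?E' = "{z\<in>space ?Q. z \<in> R \<and> f (fst z) \<in> A}"
  let ?F = "{z\<in>space ?Q. z \<notin> R \<and> f (fst z) \<in> A}"
  have "emeasure ?Q ?E = emeasure (distr ?Q ?Q (\<lambda>(x, y). (y, x))) ?E"
    by (subst Q.distr_pair_swap) simp
  also have "\<dots> = emeasure ?Q ?E'"
    by (subst emeasure_distr)
      (auto simp: space_pair_measure sym intro!: arg_cong[where f="emeasure ?Q"])
  finally have E: "emeasure ?Q ?E = emeasure ?Q ?E'" .
  have "emeasure (distr ?Q N ?T) A = emeasure ?Q (?E \<union> ?F)"
    by (subst emeasure_distr) (auto intro!: arg_cong[where f="emeasure ?Q"] split: if_splits)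
  also have "\<dots> = emeasure ?Q (?E' \<union> ?F)"
    by (subst (1 2) plus_emeasure[symmetric]) (auto simp: E)
  also have "?E' \<union> ?F = (f -` A \<inter> space M) \<times> space M"
    by (auto simp: space_pair_measure)
  also have "emeasure ?Q \<dots> = emeasure (distr M N f) A"
    by (simp add: emeasure_pair_measure_Times emeasure_space_1 emeasure_distr)
  finally show "emeasure (distr ?Q N ?T) A = emeasure (distr M N f) A" .
qed simp

text \<open>The bound \<open>k\<close> on \<open>R\<close> makes the change caused by the swap
  integrable, although integrability of \<open>A\<close> and \<open>B\<close> separately is not
  assumed. Symmetrising this change over the two copies yields \<open>- G\<close>, hence the factor
  one half.\<close>

lemma integral_swap_on_symmetric:
  fixes A B :: "'a \<Rightarrow> real"
  assumes [measurable]: "A \<in> borel_measurable M" "B \<in> borel_measurable M"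
    and AB: "integrable M (\<lambda>\<omega>. A \<omega> * B \<omega>)"
    and R[measurable]: "R \<in> sets (M \<Otimes>\<^sub>M M)"
    and sym: "\<And>x y. (x, y) \<in> R \<longleftrightarrow> (y, x) \<in> R"
    and bounded: "\<And>z. z \<in> R \<Longrightarrow> \<bar>A (fst z)\<bar> \<le> k \<and> \<bar>B (fst z)\<bar> \<le> k"
  defines "G \<equiv> \<lambda>z. indicator R z * ((A (fst z) - A (snd z)) * (B (fst z) - B (snd z)))"
    and "Z \<equiv> \<lambda>z. A (fst z) * (if z \<in> R then B (snd z) else B (fst z))"
  shows "integrable (M \<Otimes>\<^sub>M M) G" "integrable (M \<Otimes>\<^sub>M M) Z"
    "integral\<^sup>L (M \<Otimes>\<^sub>M M) Z = (\<integral>\<omega>. A \<omega> * B \<omega> \<partial>M) - integral\<^sup>L (M \<Otimes>\<^sub>M M) G / 2"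
proof -
  interpret Q: pair_prob_space M M ..
  let ?Q = "M \<Otimes>\<^sub>M M"
  define H where "H z = indicator R z * (A (fst z) * (B (snd z) - B (fst z)))" for z
  have [measurable]: "H \<in> borel_measurable ?Q"
    unfolding H_def by measurable
  have bounded': "\<bar>A (snd z)\<bar> \<le> k" "\<bar>B (snd z)\<bar> \<le> k" if "z \<in> R" for z
    using that bounded[of "(snd z, fst z)"] sym[of "fst z" "snd z"] by auto
  have H_bound: "norm (H z) \<le> k * (2 * k)" for z
  proof (cases "z \<in> R")
    case True
    then show ?thesis
      using bounded[OF True] bounded'[OF True]
      by (auto simp: H_def abs_mult intro!: mult_mono)
  qed (simp add: H_def)
  have H: "integrable ?Q H"
    by (rule Q.integrable_const_bound[of _ "k * (2 * k)"]) (use H_bound in auto)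
  have H': "integrable ?Q (\<lambda>(x, y). H (y, x))"
    by (rule Q.integrable_product_swap[OF H])
  \<comment> \<open>\<open>H\<close> is the change of the integrand under the swap. On
    \<open>R\<close>, adding \<open>A x * (B y - B x)\<close> and \<open>A y * (B x - B y)\<close>
    gives minus the product of the increments.\<close>
  have GH: "G = (\<lambda>z. - (H z + (case z of (x, y) \<Rightarrow> H (y, x))))"
    by (auto simp: G_def H_def fun_eq_iff sym indicator_def algebra_simps)
  show "integrable ?Q G"
    unfolding GH using H H' by auto
  have G: "integral\<^sup>L ?Q G = - 2 * integral\<^sup>L ?Q H"
    unfolding GH using H H' Q.integral_product_swap[of H] by simp
  have fst: "distr ?Q M fst = M"
    by (rule distr_pair_fst)
  have ABf: "integrable ?Q (\<lambda>z. A (fst z) * B (fst z))"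
    by (rule integrable_distr[of fst _ M "\<lambda>\<omega>. A \<omega> * B \<omega>"]) (simp_all add: fst AB)
  have ABi: "(\<integral>z. A (fst z) * B (fst z) \<partial>?Q) = (\<integral>\<omega>. A \<omega> * B \<omega> \<partial>M)"
    by (subst (2) fst[symmetric], subst integral_distr) auto
  have Z: "Z = (\<lambda>z. A (fst z) * B (fst z) + H z)"
    by (auto simp: Z_def H_def fun_eq_iff algebra_simps)
  show "integrable ?Q Z"
    unfolding Z using ABf H by auto
  show "integral\<^sup>L ?Q Z = (\<integral>\<omega>. A \<omega> * B \<omega> \<partial>M) - integral\<^sup>L ?Q G / 2"
    unfolding Z G using ABf H ABi by simp
qed

text \<open>The sign \<open>s\<close> treats both problems at once: 1 for the maximum, -1 for the
  minimum. Swapping exactly where the integrand has the wrong sign would be a strict improvement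
  unless that event is null.\<close>

lemma AE_pair_if_swaps_not_better:
  fixes A B :: "'a \<Rightarrow> real" and s :: real
  assumes [measurable]: "A \<in> borel_measurable M" "B \<in> borel_measurable M"
    and AB: "integrable M (\<lambda>\<omega>. A \<omega> * B \<omega>)"
    and opt: "\<And>R Z. \<lbrakk>R \<in> sets (M \<Otimes>\<^sub>M M); \<And>x y. (x, y) \<in> R \<longleftrightarrow> (y, x) \<in> R;
        Z = (\<lambda>z. A (fst z) * (if z \<in> R then B (snd z) else B (fst z)));
        integrable (M \<Otimes>\<^sub>M M) Z\<rbrakk>
      \<Longrightarrow> s * integral\<^sup>L (M \<Otimes>\<^sub>M M) Z \<le> s * (\<integral>\<omega>. A \<omega> * B \<omega> \<partial>M)"
  shows "AE z in M \<Otimes>\<^sub>M M. 0 \<le> s * ((A (fst z) - A (snd z)) * (B (fst z) - B (snd z)))"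
proof -
  let ?Q = "M \<Otimes>\<^sub>M M"
  define W where "W z = (A (fst z) - A (snd z)) * (B (fst z) - B (snd z))" for z
  have [measurable]: "W \<in> borel_measurable ?Q"
    unfolding W_def by measurable
  \<comment> \<open>The truncation bounds both copies so that \<open>R k\<close> stays
    symmetric.\<close>
  define R where "R k = {z\<in>space ?Q. s * W z < 0 \<and> \<bar>A (fst z)\<bar> \<le> k \<and> \<bar>A (snd z)\<bar> \<le> k \<and>
    \<bar>B (fst z)\<bar> \<le> k \<and> \<bar>B (snd z)\<bar> \<le> k}" for k :: real
  have "AE z in ?Q. z \<notin> R k" for k
  proof -
    define G where "G z = indicator (R k) z * W z" for z
    define Z where "Z z = A (fst z) * (if z \<in> R k then B (snd z) else B (fst z))" for z
    have R: "R k \<in> sets ?Q"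
      unfolding R_def by measurable
    have sym: "(x, y) \<in> R k \<longleftrightarrow> (y, x) \<in> R k" for x y
      by (auto simp: R_def W_def space_pair_measure algebra_simps)
    have bounded: "\<bar>A (fst z)\<bar> \<le> k \<and> \<bar>B (fst z)\<bar> \<le> k" if "z \<in> R k" for z
      using that by (auto simp: R_def)
    note swap = integral_swap_on_symmetric[OF assms(1-3) R sym bounded]
    have G: "integrable ?Q G"
      unfolding G_def W_def by (rule swap(1))
    have Z: "integrable ?Q Z"
      unfolding Z_def by (rule swap(2))
    have ZG: "integral\<^sup>L ?Q Z = (\<integral>\<omega>. A \<omega> * B \<omega> \<partial>M) - integral\<^sup>L ?Q G / 2"
      unfolding Z_def G_def W_def by (rule swap(3))
    have int: "integrable ?Q (\<lambda>z. - s * G z)"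
      using G by auto
    have nonneg: "0 \<le> - s * G z" for z
      by (auto simp: G_def R_def indicator_def)
    \<comment> \<open>The swap changes the expectation by minus half the integral of
      \<open>G\<close>, so optimality forces \<open>s\<close> times that integral to be nonnegative.
      But \<open>s * G\<close> is nowhere positive, hence it vanishes almost everywhere.\<close>
    have "s * integral\<^sup>L ?Q Z \<le> s * (\<integral>\<omega>. A \<omega> * B \<omega> \<partial>M)"
      using R sym _ Z by (rule opt) (simp add: Z_def fun_eq_iff)
    then have "0 \<le> s * integral\<^sup>L ?Q G"
      unfolding ZG by (simp add: right_diff_distrib)
    then have "(\<integral>z. - s * G z \<partial>?Q) \<le> 0"
      by simp
    then have "(\<integral>z. - s * G z \<partial>?Q) = 0"
      by (rule antisym) (rule Bochner_Integration.integral_nonneg, rule nonneg)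
    then have "AE z in ?Q. - s * G z = 0"
      using integral_nonneg_eq_0_iff_AE[OF int] nonneg by simp
    then show ?thesis
      by eventually_elim (auto simp: G_def R_def)
  qed
  then have "AE z in ?Q. \<forall>n. z \<notin> R (real n)"
    by (simp add: AE_all_countable)
  then show ?thesis
    using AE_space
  proof eventually_elim
    case (elim z)
    \<comment> \<open>Every point passes the truncation at some level \<open>n\<close>, so avoiding
      all \<open>R (real n)\<close> leaves only the sign condition to fail.\<close>
    obtain n where "Max {\<bar>A (fst z)\<bar>, \<bar>A (snd z)\<bar>, \<bar>B (fst z)\<bar>, \<bar>B (snd z)\<bar>} \<le> real n"
      using real_arch_simple by blast
    with elim show ?case
      using elim(1)[rule_format, of n] by (auto simp: R_def W_def)
  qed
qed

end

section \<open>Swapped random vectors as competitors\<close>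

text \<open>This is what lets optimality be applied to swaps: moving the coordinates outside
  \<open>I\<close> to the second copy on \<open>R\<close> keeps every marginal. The new vector lives
  on the product space, and \<open>product_expectations_any_space\<close> transfers its
  expectation.\<close>

lemma swapped_product_expectation:
  fixes P :: "'a measure"
  assumes X: "random_vector_with_marginals P d F X" and I: "I \<subseteq> {1..d}"
    and R: "R \<in> sets (P \<Otimes>\<^sub>M P)" "\<And>x y. (x, y) \<in> R \<longleftrightarrow> (y, x) \<in> R"
    and Z: "Z = (\<lambda>z. (\<Prod>i\<in>I. X i (fst z)) *
      (if z \<in> R then \<Prod>i\<in>{1..d} - I. X i (snd z) else \<Prod>i\<in>{1..d} - I. X i (fst z)))"
    and int: "integrable (P \<Otimes>\<^sub>M P) Z"
  shows "ereal (integral\<^sup>L (P \<Otimes>\<^sub>M P) Z) \<in> product_expectations d F"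
proof -
  interpret prob_space P
    using X by (simp add: random_vector_with_marginals_def)
  interpret Q: pair_prob_space P P ..
  let ?Q = "P \<Otimes>\<^sub>M P"
  have Xm: "X i \<in> borel_measurable P" "cdf (distr P borel (X i)) = F i" if "i \<in> {1..d}" for i
    using X that by (auto simp: random_vector_with_marginals_def has_df_def)
  define Y where "Y i z = (if i \<notin> I \<and> z \<in> R then X i (snd z) else X i (fst z))" for i z
  have "has_df ?Q (Y i) (F i)" if i: "i \<in> {1..d}" for i
  proof -
    \<comment> \<open>An unswapped coordinate is a swap on the empty event, so one argument covers
      both kinds.\<close>
    define S where "S = (if i \<in> I then {} else R)"
    have [measurable]: "X i \<in> borel_measurable P" "S \<in> sets ?Q"
      using Xm(1)[OF i] R(1) by (auto simp: S_def)
    have Y: "Y i = (\<lambda>z. if z \<in> S then X i (snd z) else X i (fst z))"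
      by (auto simp: Y_def S_def fun_eq_iff)
    have "distr ?Q borel (Y i) = distr P borel (X i)"
      unfolding Y by (rule distr_swap_on_symmetric[OF \<open>X i \<in> _\<close> \<open>S \<in> _\<close>]) (use R(2) in \<open>simp_all add: S_def\<close>)
    moreover have "Y i \<in> borel_measurable ?Q"
      unfolding Y by measurable
    ultimately show ?thesis
      by (simp add: has_df_def Xm(2)[OF i])
  qed
  then have rv: "random_vector_with_marginals ?Q d F Y"
    by (simp add: random_vector_with_marginals_def Q.prob_space_axioms)
  have "Z z = (\<Prod>i\<in>{1..d}. Y i z)" for z
  proof -
    have "(\<Prod>i\<in>{1..d}. Y i z) = (\<Prod>i\<in>{1..d} - I. Y i z) * (\<Prod>i\<in>I. Y i z)"
      by (rule prod.subset_diff[OF I]) simp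
    also have "(\<Prod>i\<in>I. Y i z) = (\<Prod>i\<in>I. X i (fst z))"
      by (rule prod.cong) (auto simp: Y_def)
    also have "(\<Prod>i\<in>{1..d} - I. Y i z) =
        (if z \<in> R then \<Prod>i\<in>{1..d} - I. X i (snd z) else \<Prod>i\<in>{1..d} - I. X i (fst z))"
      by (auto simp: Y_def intro!: prod.cong)
    finally show ?thesis
      by (simp add: Z mult.commute)
  qed
  then have "Z = (\<lambda>z. \<Prod>i\<in>{1..d}. Y i z)" ..
  then show ?thesis
    using product_expectations_any_space[OF rv] ext_expectation_integrable[OF int] by simp
qed

text \<open>Integrability of the full product makes the attained optimum a real number, so that a
  swap with a strictly better expectation contradicts it.\<close>

theorem lemma3p3:
  fixes P :: "'a measure" and d :: nat
    and F :: "nat \<Rightarrow> real \<Rightarrow> real" and X :: "nat \<Rightarrow> 'a \<Rightarrow> real"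
  assumes "d \<ge> 2"
    and "\<And>i. i \<in> {1..d} \<Longrightarrow> distribution_function (F i)"
    and "random_vector_with_marginals P d F X"
    and "\<And>i. i \<in> {1..d} \<Longrightarrow> integrable P (\<lambda>\<omega>. (X i \<omega>)\<^sup>2)"
    and "integrable P (\<lambda>\<omega>. \<Prod>i\<in>{1..d}. X i \<omega>)"
  shows "(solves_max P d F X \<longrightarrow>
            (\<forall>I \<subseteq> {1..d}. comonotonic P (\<lambda>\<omega>. \<Prod>i\<in>I. X i \<omega>) (\<lambda>\<omega>. \<Prod>i\<in>{1..d} - I. X i \<omega>)))
       \<and> (solves_min P d F X \<longrightarrow>
            (\<forall>I \<subseteq> {1..d}. antimonotonic P (\<lambda>\<omega>. \<Prod>i\<in>I. X i \<omega>) (\<lambda>\<omega>. \<Prod>i\<in>{1..d} - I. X i \<omega>)))"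
proof (intro conjI impI allI)
  interpret prob_space P
    using assms(3) by (simp add: random_vector_with_marginals_def)
  let ?A = "\<lambda>I \<omega>. \<Prod>i\<in>I. X i \<omega>" and ?B = "\<lambda>I \<omega>. \<Prod>i\<in>{1..d} - I. X i \<omega>"
  have meas: "?A I \<in> borel_measurable P" "?B I \<in> borel_measurable P" if "I \<subseteq> {1..d}" for I
    using that assms(3)
    by (auto simp: random_vector_with_marginals_def has_df_def intro!: borel_measurable_prod)
  have AB: "(\<lambda>\<omega>. ?A I \<omega> * ?B I \<omega>) = (\<lambda>\<omega>. \<Prod>i\<in>{1..d}. X i \<omega>)" if "I \<subseteq> {1..d}" for I
    by (intro ext) (simp add: prod.subset_diff[OF that] mult.commute del: One_nat_def)
  have ext: "ext_expectation P (\<lambda>\<omega>. \<Prod>i\<in>{1..d}. X i \<omega>) = ereal (\<integral>\<omega>. (\<Prod>i\<in>{1..d}. X i \<omega>) \<partial>P)"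
    by (rule ext_expectation_integrable[OF assms(5)])
  \<comment> \<open>Comparison with real values \<open>e\<close> suffices, because the truncated
    swaps have integrable products.\<close>
  have AE: "AE z in P \<Otimes>\<^sub>M P.
      0 \<le> s * ((?A I (fst z) - ?A I (snd z)) * (?B I (fst z) - ?B I (snd z)))"
    if I: "I \<subseteq> {1..d}" and opt: "\<And>e. ereal e \<in> product_expectations d F \<Longrightarrow>
      s * e \<le> s * (\<integral>\<omega>. (\<Prod>i\<in>{1..d}. X i \<omega>) \<partial>P)" for I and s :: real
  proof (rule AE_pair_if_swaps_not_better[OF meas[OF I]], goal_cases)
    case 1
    then show ?case
      unfolding AB[OF I] by (rule assms(5))
  next
    case (2 R Z)
    then show ?case
      unfolding AB[OF I] by (intro opt swapped_product_expectation[OF assms(3) I])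
  qed
  show "comonotonic P (?A I) (?B I)" if "solves_max P d F X" "I \<subseteq> {1..d}" for I
  proof (rule comonotonic_if_AE_pair[OF meas[OF that(2)]])
    have "e \<le> (\<integral>\<omega>. (\<Prod>i\<in>{1..d}. X i \<omega>) \<partial>P)" if "ereal e \<in> product_expectations d F" for e
      using Sup_upper[OF that] \<open>solves_max P d F X\<close>
      by (metis ext max_product_def solves_max_def ereal_less_eq(3))
    then show "AE z in P \<Otimes>\<^sub>M P.
        0 \<le> (?A I (fst z) - ?A I (snd z)) * (?B I (fst z) - ?B I (snd z))"
      using AE[OF that(2), of 1] by simp
  qed
  show "antimonotonic P (?A I) (?B I)" if "solves_min P d F X" "I \<subseteq> {1..d}" for I
  proof (rule antimonotonic_if_AE_pair[OF meas[OF that(2)]])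
    have "(\<integral>\<omega>. (\<Prod>i\<in>{1..d}. X i \<omega>) \<partial>P) \<le> e" if "ereal e \<in> product_expectations d F" for e
      using Inf_lower[OF that] \<open>solves_min P d F X\<close>
      by (metis ext min_product_def solves_min_def ereal_less_eq(3))
    then show "AE z in P \<Otimes>\<^sub>M P.
        (?A I (fst z) - ?A I (snd z)) * (?B I (fst z) - ?B I (snd z)) \<le> 0"
      using AE[OF that(2), of "-1"] by simp
  qed
qed

end
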